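(* Let $\mathbb{K}$ be an algebraically closed field of characteristic $0$ or of prime characteristic $p\ge 7$, and let $m\ge 5$ be an integer, with $m\le p-1$ if $\mathbb{K}$ has characteristic $p$. Let $V$ be the curve in $\mathrm{PG}(m-1,\mathbb{K})$ defined by $X_1^k+\cdots+X_m^k=0$ for $1\le k\le m-2$, and let $G\cong\mathrm{Sym}_m$ act on $V$ by permuting the homogeneous coordinates. Let $\omega\in\mathbb{K}$ be a primitive $m$-th root of unity and let $\Omega_\omega$ be the $G$-orbit of the point $P_\omega=(\omega:\omega^2:\cdots:\omega^m=1)$ of $V$. Then $\Omega_\omega$ consists precisely of the common points of $V$ and the hypersurface of equation $$X_1^{m-1}+X_2^{m-1}+\cdots+X_m^{m-1}=0.$$ *)

theory Defs
  imports
    "HOL-Computational_Algebra.Computational_Algebra"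
    "HOL-Algebra.Group_Action"
    "HOL-Algebra.Sym_Groups"
begin

text \<open>
  Vectors of \<open>K\<^sup>m\<close> are functions \<open>nat \<Rightarrow> K\<close> that vanish outside \<open>{1..m}\<close>, so that
  coordinates are numbered from 1 to m, matching the carrier of \<^const>\<open>sym_group\<close>.
\<close>

definition nonzero_vecs :: "nat \<Rightarrow> (nat \<Rightarrow> 'a::field) set" where
  "nonzero_vecs m = {x. (\<forall>i. i \<notin> {1..m} \<longrightarrow> x i = 0) \<and> (\<exists>i\<in>{1..m}. x i \<noteq> 0)}"

definition proportional :: "nat \<Rightarrow> ((nat \<Rightarrow> 'a::field) \<times> (nat \<Rightarrow> 'a)) set" where
  "proportional m =
     {(x, y). x \<in> nonzero_vecs m \<and> y \<in> nonzero_vecs m \<and> (\<exists>c. c \<noteq> 0 \<and> y = (\<lambda>i. c * x i))}"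

text \<open>
  The projective space \<open>PG(d, K)\<close>, with \<open>d + 1\<close> homogeneous coordinates; a point is the set
  of all its coordinate vectors.
\<close>

definition PG :: "nat \<Rightarrow> (nat \<Rightarrow> 'a::field) set set" where
  "PG d = nonzero_vecs (d + 1) // proportional (d + 1)"

text \<open>The point \<open>(x 1 : \<dots> : x (d + 1))\<close>; the other values of \<open>x\<close> are discarded.\<close>

definition proj_point :: "nat \<Rightarrow> (nat \<Rightarrow> 'a::field) \<Rightarrow> (nat \<Rightarrow> 'a) set" where
  "proj_point d x = proportional (d + 1) `` {\<lambda>i. if i \<in> {1..d + 1} then x i else 0}"

text \<open>The set of common zeros in \<open>PG(d, K)\<close> of a set of forms.\<close>

definition proj_zeros :: "nat \<Rightarrow> ((nat \<Rightarrow> 'a::field) \<Rightarrow> 'a) set \<Rightarrow> (nat \<Rightarrow> 'a) set set" where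
  "proj_zeros d F = {P \<in> PG d. \<forall>f\<in>F. \<forall>x\<in>P. f x = 0}"

definition power_sum :: "nat \<Rightarrow> nat \<Rightarrow> (nat \<Rightarrow> 'a::field) \<Rightarrow> 'a" where
  "power_sum m k x = (\<Sum>i=1..m. x i ^ k)"

definition curve_V :: "nat \<Rightarrow> (nat \<Rightarrow> 'a::field) set set" where
  "curve_V m = proj_zeros (m - 1) ((\<lambda>k. power_sum m k) ` {1..m - 2})"

text \<open>
  \<open>\<sigma>\<close> moves the i-th coordinate to position \<open>\<sigma> i\<close>; the inverse makes this a left action.
  As \<^const>\<open>group_action\<close> requires, it is extensional on \<^const>\<open>curve_V\<close>.
\<close>

definition coord_action ::
    "nat \<Rightarrow> (nat \<Rightarrow> nat) \<Rightarrow> (nat \<Rightarrow> 'a::field) set \<Rightarrow> (nat \<Rightarrow> 'a) set" where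
  "coord_action m \<sigma> = (\<lambda>P\<in>curve_V m. (\<lambda>x. x \<circ> inv' \<sigma>) ` P)"

definition primitive_root_of_unity :: "nat \<Rightarrow> 'a::field \<Rightarrow> bool" where
  "primitive_root_of_unity m w \<longleftrightarrow> m > 0 \<and> w ^ m = 1 \<and> (\<forall>k\<in>{0<..<m}. w ^ k \<noteq> 1)"

definition P_point :: "nat \<Rightarrow> 'a::field \<Rightarrow> (nat \<Rightarrow> 'a) set" where
  "P_point m w = proj_point (m - 1) (\<lambda>i. w ^ i)"

definition Omega_orbit :: "nat \<Rightarrow> 'a::field \<Rightarrow> (nat \<Rightarrow> 'a) set set" where
  "Omega_orbit m w = orbit (sym_group m) (coord_action m) (P_point m w)"

lemma nonzero_vecs_permute:
  assumes "\<sigma> permutes {1..m}" "x \<in> nonzero_vecs m"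
  shows "x \<circ> \<sigma> \<in> nonzero_vecs m"
proof -
  from assms(2) obtain i where i: "i \<in> {1..m}" "x i \<noteq> 0"
    and z: "\<And>i. i \<notin> {1..m} \<Longrightarrow> x i = 0"
    unfolding nonzero_vecs_def by blast
  from i(1) obtain j where "j \<in> {1..m}" "\<sigma> j = i"
    using permutes_image[OF assms(1)] by (metis imageE)
  moreover have "x (\<sigma> j) = 0" if "j \<notin> {1..m}" for j
    using z that permutes_not_in[OF assms(1) that] by simp
  ultimately show ?thesis using i(2) unfolding nonzero_vecs_def by auto
qed

lemma power_sum_permute:
  assumes "\<sigma> permutes {1..m}"
  shows "power_sum m k (x \<circ> \<sigma>) = power_sum m k x"
  using sum.permute[OF assms, of "\<lambda>i. x i ^ k"] by (simp add: power_sum_def o_def)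

lemma curve_V_permute:
  assumes s: "\<sigma> permutes {1..m}" and P: "P \<in> curve_V m" and m: "m \<ge> 1"
  shows "(\<lambda>x. x \<circ> \<sigma>) ` P \<in> curve_V m"
proof -
  have m': "m - 1 + 1 = m" using m by simp
  from P obtain x where x: "x \<in> nonzero_vecs m" and Px: "P = proportional m `` {x}"
    unfolding curve_V_def proj_zeros_def PG_def m' by (auto elim: quotientE)
  have "(\<lambda>x. x \<circ> \<sigma>) ` P = proportional m `` {x \<circ> \<sigma>}"
  proof (intro equalityI subsetI)
    fix y assume "y \<in> (\<lambda>x. x \<circ> \<sigma>) ` P"
    then obtain c where "c \<noteq> 0" "y = (\<lambda>i. c * x i) \<circ> \<sigma>" "(\<lambda>i. c * x i) \<in> nonzero_vecs m"
      unfolding Px proportional_def by auto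
    then show "y \<in> proportional m `` {x \<circ> \<sigma>}"
      using nonzero_vecs_permute[OF s] x unfolding proportional_def by (auto simp: o_def)
  next
    fix y assume "y \<in> proportional m `` {x \<circ> \<sigma>}"
    then obtain c where c: "c \<noteq> 0" "y = (\<lambda>i. c * x (\<sigma> i))"
      unfolding proportional_def by auto
    have "(\<lambda>i. c * x i) \<in> nonzero_vecs m" using x c(1) unfolding nonzero_vecs_def by auto
    then have "(\<lambda>i. c * x i) \<in> P" using x c(1) unfolding Px proportional_def by auto
    then show "y \<in> (\<lambda>x. x \<circ> \<sigma>) ` P" using c(2) by (auto simp: o_def image_iff)
  qed
  then have "(\<lambda>x. x \<circ> \<sigma>) ` P \<in> PG (m - 1)"
    unfolding PG_def m' using nonzero_vecs_permute[OF s x] by (simp add: quotientI)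
  then show ?thesis
    using P unfolding curve_V_def proj_zeros_def by (auto simp: power_sum_permute[OF s])
qed

lemma group_action_coord_action:
  assumes m: "m \<ge> 1"
  shows "group_action (sym_group m) (curve_V m :: (nat \<Rightarrow> 'a::field) set set) (coord_action m)"
proof -
  let ?V = "curve_V m :: (nat \<Rightarrow> 'a) set set"
  have bij: "coord_action m \<sigma> \<in> Bij ?V" if s: "\<sigma> permutes {1..m}" for \<sigma>
  proof -
    have "bij_betw (coord_action m \<sigma>) ?V ?V"
    proof (rule bij_betwI[where g = "\<lambda>P. (\<lambda>x. x \<circ> \<sigma>) ` P"])
      show "coord_action m \<sigma> \<in> ?V \<rightarrow> ?V"
        using curve_V_permute[OF permutes_inv[OF s] _ m] by (auto simp: coord_action_def)
      show "(\<lambda>P. (\<lambda>x. x \<circ> \<sigma>) ` P) \<in> ?V \<rightarrow> ?V"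
        using curve_V_permute[OF s _ m] by auto
    next
      fix P assume "P \<in> ?V"
      then show "(\<lambda>x. x \<circ> \<sigma>) ` coord_action m \<sigma> P = P"
        using permutes_inv_o[OF s] by (simp add: coord_action_def image_image o_assoc[symmetric])
    next
      fix P assume "P \<in> ?V"
      then show "coord_action m \<sigma> ((\<lambda>x. x \<circ> \<sigma>) ` P) = P"
        using permutes_inv_o[OF s] curve_V_permute[OF s \<open>P \<in> ?V\<close> m]
        by (simp add: coord_action_def image_image o_assoc[symmetric])
    qed
    then show ?thesis by (simp add: Bij_def coord_action_def)
  qed
  have "coord_action m (\<sigma> \<circ> \<tau>) = compose ?V (coord_action m \<sigma>) (coord_action m \<tau>)"
    if s: "\<sigma> permutes {1..m}" and t: "\<tau> permutes {1..m}" for \<sigma> \<tau>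
  proof
    fix P :: "(nat \<Rightarrow> 'a) set"
    have "inv' (\<sigma> \<circ> \<tau>) = inv' \<tau> \<circ> inv' \<sigma>"
      using o_inv_distrib[OF permutes_bij[OF s] permutes_bij[OF t]] .
    then show "coord_action m (\<sigma> \<circ> \<tau>) P = compose ?V (coord_action m \<sigma>) (coord_action m \<tau>) P"
      by (simp add: coord_action_def compose_def image_image o_assoc
          curve_V_permute[OF permutes_inv[OF t] _ m])
  qed
  then have "coord_action m \<in> hom (sym_group m) (BijGroup ?V)"
    using bij by (auto simp: hom_def sym_group_def BijGroup_def)
  then show ?thesis
    by (simp add: group_action_def group_hom_def group_hom_axioms_def
        sym_group_is_group group_BijGroup)
qed

end

theory Submission
  imports Defs
begin

text \<open>
  Let \<open>f = \<Prod>(T - x\<^sub>i)\<close> and \<open>f = (T - x\<^sub>i) q\<^sub>i\<close>, so that \<open>f' = \<Sum> q\<^sub>i\<close>. If the power sums of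
  degrees \<open>1, \<dots>, m - 1\<close> vanish, expanding the coefficients of the \<open>q\<^sub>i\<close> by Horner's rule gives
  \<open>(k + 1) a\<^sub>k\<^sub>+\<^sub>1 = m a\<^sub>k\<^sub>+\<^sub>1\<close> for the coefficients \<open>a\<^sub>j\<close> of \<open>f\<close>. As \<open>m\<close> is smaller than a positive
  characteristic, \<open>f = T\<^sup>m + a\<^sub>0\<close>. The \<open>m\<close> distinct elements \<open>x\<^sub>m \<omega>\<^sup>j\<close> are roots of \<open>f\<close>, hence they
  are the \<open>x\<^sub>i\<close> in some order.
\<close>

section \<open>Power sums and the coefficients of a split polynomial\<close>

text \<open>Horner's rule for \<open>f = (T - x i) * q i\<close> turns the sum at
  \<open>(l, k)\<close> into a multiple of the power sum of degree \<open>l\<close> plus the sum at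
  \<open>(l + 1, k + 1)\<close>. Iterating raises \<open>k\<close> until all cofactor coefficients
  vanish.\<close>

lemma sum_power_coeff_cofactor_eq_0:
  fixes x :: "'b \<Rightarrow> 'a::idom"
  assumes fin: "finite A"
    and ps: "\<And>l. 1 \<le> l \<Longrightarrow> l < card A \<Longrightarrow> (\<Sum>i\<in>A. x i ^ l) = 0"
    and "1 \<le> l" "l \<le> k"
  shows "(\<Sum>i\<in>A. x i ^ l * coeff (\<Prod>j\<in>A - {i}. [:- x j, 1:]) k) = 0"
  using \<open>1 \<le> l\<close> \<open>l \<le> k\<close>
\<comment> \<open>The induction descends in \<open>k\<close>. Its base case is
  \<open>card A \<le> k\<close>, beyond the degree of every cofactor.\<close>
proof (induction "card A - k" arbitrary: k l)
  case 0
  have "coeff (\<Prod>j\<in>A - {i}. [:- x j, 1:]) k = 0" if "i \<in> A" for i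
  proof (rule coeff_eq_0)
    have "degree (\<Prod>j\<in>A - {i}. [:- x j, 1:]) \<le> card (A - {i})"
      using degree_prod_sum_le[of "A - {i}" "\<lambda>j. [:- x j, 1:]"] fin by simp
    also have "\<dots> < card A" using fin that by (rule card_Diff1_less)
    finally show "degree (\<Prod>j\<in>A - {i}. [:- x j, 1:]) < k" using 0 by simp
  qed
  then show ?case by simp
next
  case (Suc n)
  let ?f = "\<Prod>j\<in>A. [:- x j, 1:]"
  let ?q = "\<lambda>i. \<Prod>j\<in>A - {i}. [:- x j, 1:]"
  have "coeff (?q i) k = coeff ?f (Suc k) + x i * coeff (?q i) (Suc k)" if "i \<in> A" for i
    by (simp add: prod.remove[OF fin that])
  then have "(\<Sum>i\<in>A. x i ^ l * coeff (?q i) k)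
      = (\<Sum>i\<in>A. coeff ?f (Suc k) * x i ^ l + x i ^ Suc l * coeff (?q i) (Suc k))"
    by (intro sum.cong) (simp_all add: algebra_simps)
  also have "\<dots> = coeff ?f (Suc k) * (\<Sum>i\<in>A. x i ^ l)
      + (\<Sum>i\<in>A. x i ^ Suc l * coeff (?q i) (Suc k))"
    by (simp only: sum.distrib sum_distrib_left)
  \<comment> \<open>Here \<open>card A - k\<close> is positive, so
    \<open>l \<le> k < card A\<close>; the bound \<open>l \<le> k\<close> survives because both
    indices rise together.\<close>
  also have "(\<Sum>i\<in>A. x i ^ l) = 0" using ps Suc by simp
  also have "(\<Sum>i\<in>A. x i ^ Suc l * coeff (?q i) (Suc k)) = 0"
    using Suc by (intro Suc.hyps(1)) simp_all
  finally show ?case by simp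
qed

text \<open>The coefficient of degree \<open>k - 1\<close> of the derivative is computed twice:
  directly as \<open>k\<close> times the coefficient of degree \<open>k\<close>, and through the
  cofactors as \<open>card A\<close> times it. The difference of the two factors is
  invertible.\<close>

lemma coeff_prod_linear_if_power_sums_eq_0:
  fixes x :: "'b \<Rightarrow> 'a::idom"
  assumes fin: "finite A"
    and ps: "\<And>l. 1 \<le> l \<Longrightarrow> l < card A \<Longrightarrow> (\<Sum>i\<in>A. x i ^ l) = 0"
    and k: "1 \<le> k" "k < card A" and nz: "of_nat (card A - k) \<noteq> (0::'a)"
  shows "coeff (\<Prod>i\<in>A. [:- x i, 1:]) k = 0"
proof -
  let ?f = "\<Prod>j\<in>A. [:- x j, 1:]"
  let ?q = "\<lambda>i. \<Prod>j\<in>A - {i}. [:- x j, 1:]"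
  obtain k' where k': "k = Suc k'" using k by (cases k) auto
  \<comment> \<open>The exponent 1 is kept so that the remaining sum is the case
    \<open>l = 1\<close> of the cofactor lemma.\<close>
  have q: "coeff (?q i) k' = coeff ?f k + x i ^ 1 * coeff (?q i) k" if "i \<in> A" for i
    by (simp add: prod.remove[OF fin that] k')
  have "of_nat k * coeff ?f k = coeff (pderiv ?f) k'"
    by (simp add: coeff_pderiv k')
  also have "\<dots> = (\<Sum>i\<in>A. coeff (?q i) k')"
    by (simp add: pderiv_prod pderiv_pCons coeff_sum)
  also have "\<dots> = of_nat (card A) * coeff ?f k + (\<Sum>i\<in>A. x i ^ 1 * coeff (?q i) k)"
    using q by (simp add: sum.distrib)
  also have "(\<Sum>i\<in>A. x i ^ 1 * coeff (?q i) k) = 0"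
    using k by (intro sum_power_coeff_cofactor_eq_0 fin ps) simp_all
  finally have "(of_nat (card A) - of_nat k) * coeff ?f k = 0"
    by (simp only: left_diff_distrib) simp
  then have "of_nat (card A - k) * coeff ?f k = 0"
    using k by (simp only: of_nat_diff less_imp_le)
  then show ?thesis using nz by simp
qed

lemma prod_linear_if_power_sums_eq_0:
  fixes x :: "'b \<Rightarrow> 'a::idom"
  assumes fin: "finite A" and "A \<noteq> {}"
    and ps: "\<And>l. 1 \<le> l \<Longrightarrow> l < card A \<Longrightarrow> (\<Sum>i\<in>A. x i ^ l) = 0"
    and nz: "\<And>k. 1 \<le> k \<Longrightarrow> k < card A \<Longrightarrow> of_nat k \<noteq> (0::'a)"
  obtains a where "(\<Prod>i\<in>A. [:- x i, 1:]) = monom 1 (card A) + [:a:]"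
proof
  let ?f = "\<Prod>i\<in>A. [:- x i, 1:]"
  have deg: "degree ?f = card A"
    by (subst degree_prod_eq_sum_degree) auto
  have "lead_coeff ?f = 1" by (simp add: lead_coeff_prod)
  show "?f = monom 1 (card A) + [:coeff ?f 0:]"
  proof (rule poly_eqI)
    fix k
    consider "k = 0" | "1 \<le> k" "k < card A" | "k = card A" "k \<noteq> 0" | "k > card A"
      by linarith
    then show "coeff ?f k = coeff (monom 1 (card A) + [:coeff ?f 0:]) k"
    proof cases
      case 1
      then show ?thesis using fin \<open>A \<noteq> {}\<close> by (simp add: card_eq_0_iff)
    next
      case 2
      \<comment> \<open>With \<open>k\<close>, also \<open>card A - k\<close> lies strictly between
        0 and \<open>card A\<close>, so \<open>nz\<close> applies to it.\<close>
      then have "coeff ?f k = 0"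
        using nz[of "card A - k"] by (intro coeff_prod_linear_if_power_sums_eq_0 fin ps) simp_all
      with 2 show ?thesis by (simp add: coeff_pCons split: nat.split)
    next
      case 3
      then show ?thesis
        using \<open>lead_coeff ?f = 1\<close> deg by (simp add: coeff_pCons split: nat.split)
    next
      case 4
      then show ?thesis using deg by (simp add: coeff_eq_0 coeff_pCons split: nat.split)
    qed
  qed
qed

section \<open>Roots of unity\<close>

lemma inj_on_primitive_root_power:
  assumes "primitive_root_of_unity m \<omega>"
  shows "inj_on (\<lambda>i. \<omega> ^ i) {1..m}"
proof (rule linorder_inj_onI)
  fix i j assume ij: "i < j" "i \<in> {1..m}" "j \<in> {1..m}"
  have "\<omega> \<noteq> 0" using assms by (auto simp: primitive_root_of_unity_def power_0_left)
  moreover have "\<omega> ^ (j - i) \<noteq> 1"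
    using assms ij by (auto simp: primitive_root_of_unity_def)
  moreover have "\<omega> ^ j = \<omega> ^ i * \<omega> ^ (j - i)" using ij by (simp flip: power_add)
  ultimately show "\<omega> ^ i \<noteq> \<omega> ^ j" by simp
qed auto

lemma sum_primitive_root_power_eq_0:
  assumes w: "primitive_root_of_unity m \<omega>" and k: "1 \<le> k" "k < m"
  shows "(\<Sum>i=1..m. (\<omega> ^ i) ^ k) = 0"
proof -
  have ne: "\<omega> ^ k \<noteq> 1" and one: "\<omega> ^ m = 1"
    using w k by (auto simp: primitive_root_of_unity_def)
  have "(\<omega> ^ k) ^ m = 1" using one by (metis mult.commute power_mult power_one)
  have "(\<Sum>i=1..m. (\<omega> ^ i) ^ k) = (\<Sum>i=1..m. (\<omega> ^ k) ^ i)"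
    by (simp add: mult.commute power_mult[symmetric])
  also have "\<dots> = (\<Sum>i<m. (\<omega> ^ k) ^ Suc i)"
    by (rule sum.reindex_bij_witness[of _ Suc "\<lambda>i. i - 1"]) auto
  also have "\<dots> = \<omega> ^ k * (\<Sum>i<m. (\<omega> ^ k) ^ i)"
    by (simp add: sum_distrib_left)
  also have "\<dots> = 0" using ne \<open>(\<omega> ^ k) ^ m = 1\<close> by (simp add: geometric_sum)
  finally show ?thesis .
qed

text \<open>The coordinates are the roots of some \<open>T ^ m + a\<close>. One nonzero root times
  the \<open>m\<close>-th roots of unity gives \<open>m\<close> distinct roots, and counting leaves
  room for no others.\<close>

lemma power_sums_eq_0_imp_permuted_roots:
  fixes x :: "nat \<Rightarrow> 'a::field"
  assumes w: "primitive_root_of_unity m \<omega>"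
    and nzero: "\<exists>i\<in>{1..m}. x i \<noteq> 0"
    and ps: "\<And>k. 1 \<le> k \<Longrightarrow> k < m \<Longrightarrow> power_sum m k x = 0"
    and char: "\<And>k. 1 \<le> k \<Longrightarrow> k < m \<Longrightarrow> of_nat k \<noteq> (0::'a)"
  obtains c \<sigma> where "c \<noteq> 0" "\<sigma> permutes {1..m}" "\<And>i. i \<in> {1..m} \<Longrightarrow> x i = c * \<omega> ^ \<sigma> i"
proof -
  have m: "m \<ge> 1" and wm: "\<omega> ^ m = 1" using w by (auto simp: primitive_root_of_unity_def)
  obtain a where f: "(\<Prod>i\<in>{1..m}. [:- x i, 1:]) = monom 1 m + [:a:]"
    using prod_linear_if_power_sums_eq_0[of "{1..m}" x] m ps char by (auto simp: power_sum_def)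
  have root: "z ^ m + a = 0 \<longleftrightarrow> z \<in> x ` {1..m}" for z
  proof -
    have "z ^ m + a = poly (\<Prod>i\<in>{1..m}. [:- x i, 1:]) z"
      unfolding f by (simp add: poly_monom)
    also have "\<dots> = 0 \<longleftrightarrow> z \<in> x ` {1..m}" by (auto simp: poly_prod)
    finally show ?thesis .
  qed
  \<comment> \<open>Any coordinate would serve: a zero one would force \<open>a = 0\<close>, and
    then all coordinates would vanish.\<close>
  define c where "c = x m"
  have xm: "x i ^ m + a = 0" if "i \<in> {1..m}" for i using root that by blast
  then have cm: "c ^ m + a = 0" using m by (simp add: c_def)
  have "c \<noteq> 0"
  proof
    assume "c = 0"
    then have "a = 0" using cm m by (simp add: power_0_left)
    then show False using nzero xm by auto
  qed
  let ?g = "\<lambda>j. c * \<omega> ^ j"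
  have inj: "inj_on ?g {1..m}"
  proof (rule inj_onI)
    fix i j assume ij: "i \<in> {1..m}" "j \<in> {1..m}" and "c * \<omega> ^ i = c * \<omega> ^ j"
    then have "\<omega> ^ i = \<omega> ^ j" using \<open>c \<noteq> 0\<close> by simp
    then show "i = j" by (rule inj_onD[OF inj_on_primitive_root_power[OF w] _ ij])
  qed
  have sub: "?g ` {1..m} \<subseteq> x ` {1..m}"
  proof
    fix z assume "z \<in> ?g ` {1..m}"
    then obtain j where "z = c * \<omega> ^ j" by blast
    then have "z ^ m = c ^ m * (\<omega> ^ m) ^ j"
      by (simp add: power_mult_distrib power_mult[symmetric] mult.commute)
    then have "z ^ m + a = 0" using cm wm by simp
    then show "z \<in> x ` {1..m}" by (simp only: root)
  qed
  \<comment> \<open>The left side has exactly \<open>m\<close> elements and the right side at most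
    \<open>m\<close>, so the inclusion is an equality; the same count makes \<open>x\<close>
    injective.\<close>
  have img: "?g ` {1..m} = x ` {1..m}"
    using sub card_image_le[of "{1..m}" x]
    by (intro card_seteq) (simp_all only: card_image[OF inj] finite_imageI finite_atLeastAtMost)
  have injx: "inj_on x {1..m}"
    by (rule eq_card_imp_inj_on) (simp_all only: img[symmetric] card_image[OF inj] finite_atLeastAtMost)
  \<comment> \<open>\<open>\<sigma> i\<close> is the exponent of \<open>\<omega>\<close> in
    \<open>x i / c\<close>; the identity outside \<open>{1..m}\<close> is what
    \<open>permutes\<close> demands.\<close>
  define \<sigma> where "\<sigma> i = (if i \<in> {1..m} then inv_into {1..m} ?g (x i) else i)" for i
  have bg: "bij_betw (inv_into {1..m} ?g) (x ` {1..m}) {1..m}"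
    using inj img by (intro bij_betw_inv_into) (simp add: bij_betw_def)
  have "bij_betw (inv_into {1..m} ?g \<circ> x) {1..m} {1..m}"
    using injx bg by (intro bij_betw_trans[of x _ "x ` {1..m}"]) (simp add: bij_betw_def)
  then have "bij_betw \<sigma> {1..m} {1..m}"
    by (rule bij_betw_cong[THEN iffD1, rotated]) (simp add: \<sigma>_def)
  then have "\<sigma> permutes {1..m}" by (rule bij_imp_permutes) (auto simp: \<sigma>_def)
  moreover have "x i = c * \<omega> ^ \<sigma> i" if "i \<in> {1..m}" for i
  proof -
    have "x i \<in> ?g ` {1..m}" using that img by blast
    then show ?thesis using that f_inv_into_f[of "x i" ?g "{1..m}"] by (simp add: \<sigma>_def)
  qed
  ultimately show ?thesis using that \<open>c \<noteq> 0\<close> by blast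
qed

section \<open>The orbit\<close>

lemma equiv_proportional:
  "equiv (nonzero_vecs m) (proportional m :: ((nat \<Rightarrow> 'a::field) \<times> (nat \<Rightarrow> 'a)) set)"
  (is "equiv _ ?R")
proof (rule equivI)
  show "?R \<subseteq> nonzero_vecs m \<times> nonzero_vecs m"
    by (auto simp: proportional_def)
  show "refl_on (nonzero_vecs m) ?R"
    by (auto simp: refl_on_def proportional_def intro: exI[of _ 1])
  show "sym ?R"
  proof (rule symI)
    fix x y :: "nat \<Rightarrow> 'a" assume "(x, y) \<in> proportional m"
    then obtain c where "c \<noteq> 0" "y = (\<lambda>i. c * x i)" "x \<in> nonzero_vecs m" "y \<in> nonzero_vecs m"
      by (auto simp: proportional_def)
    then show "(y, x) \<in> proportional m"
      by (auto simp: proportional_def intro!: exI[of _ "inverse c"])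
  qed
  show "trans ?R"
  proof (rule transI)
    fix x y z :: "nat \<Rightarrow> 'a"
    assume "(x, y) \<in> proportional m" "(y, z) \<in> proportional m"
    then obtain c d where cd: "c \<noteq> 0" "d \<noteq> 0" "y = (\<lambda>i. c * x i)" "z = (\<lambda>i. d * y i)"
      and "x \<in> nonzero_vecs m" "z \<in> nonzero_vecs m"
      by (auto simp: proportional_def)
    moreover have "z = (\<lambda>i. (d * c) * x i)" using cd by (simp add: mult.assoc)
    ultimately show "(x, z) \<in> proportional m"
      unfolding proportional_def by (auto intro: exI[of _ "d * c"])
  qed
qed

text \<open>Permuting coordinates commutes with scaling, so the orbit can be computed on
  representatives.\<close>

lemma proportional_permute:
  assumes s: "\<sigma> permutes {1..m}" and x: "x \<in> nonzero_vecs m"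
  shows "(\<lambda>y. y \<circ> \<sigma>) ` (proportional m `` {x}) = proportional m `` {x \<circ> \<sigma>}"
proof (intro equalityI subsetI)
  fix y assume "y \<in> (\<lambda>x. x \<circ> \<sigma>) ` (proportional m `` {x})"
  then obtain c where "c \<noteq> 0" "y = (\<lambda>i. c * x i) \<circ> \<sigma>" "(\<lambda>i. c * x i) \<in> nonzero_vecs m"
    unfolding proportional_def by auto
  then show "y \<in> proportional m `` {x \<circ> \<sigma>}"
    using nonzero_vecs_permute[OF s] x unfolding proportional_def by (auto simp: o_def)
next
  fix y assume "y \<in> proportional m `` {x \<circ> \<sigma>}"
  then obtain c where c: "c \<noteq> 0" "y = (\<lambda>i. c * x (\<sigma> i))"
    unfolding proportional_def by auto
  have "(\<lambda>i. c * x i) \<in> proportional m `` {x}"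
    using x c(1) unfolding proportional_def nonzero_vecs_def by auto
  then show "y \<in> (\<lambda>x. x \<circ> \<sigma>) ` (proportional m `` {x})"
    using c(2) by (auto simp: o_def image_iff)
qed

lemma power_sum_scale: "power_sum m k (\<lambda>i. c * x i) = c ^ k * power_sum m k x"
  by (simp add: power_sum_def power_mult_distrib sum_distrib_left)

text \<open>Power sums are homogeneous, so their vanishing at a point can be tested on a single
  representative.\<close>

lemma proj_zeros_power_sum:
  assumes "m \<ge> 1"
  shows "proj_zeros (m - 1) (power_sum m ` K)
    = {proportional m `` {x} |x. x \<in> nonzero_vecs m \<and> (\<forall>k\<in>K. power_sum m k x = 0)}"
    (is "?L = ?R")
proof (intro equalityI subsetI)
  fix P :: "(nat \<Rightarrow> 'a) set" assume P: "P \<in> ?L"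
  then obtain x where x: "x \<in> nonzero_vecs m" "P = proportional m `` {x}"
    using assms by (auto simp: proj_zeros_def PG_def elim: quotientE)
  then have "x \<in> P" using equiv_class_self[OF equiv_proportional] by blast
  then have "\<forall>k\<in>K. power_sum m k x = 0" using P by (auto simp: proj_zeros_def)
  then show "P \<in> ?R" using x by blast
next
  fix P :: "(nat \<Rightarrow> 'a) set" assume "P \<in> ?R"
  then obtain x where x: "x \<in> nonzero_vecs m" "P = proportional m `` {x}"
    "\<forall>k\<in>K. power_sum m k x = 0" by blast
  then have "\<forall>k\<in>K. \<forall>y\<in>P. power_sum m k y = 0"
    by (auto simp: proportional_def power_sum_scale)
  then show "P \<in> ?L" using x assms by (auto simp: proj_zeros_def PG_def quotientI)
qed

theorem lemma5p2:
  fixes m :: nat and \<omega> :: "'a::alg_closed_field"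
  assumes "CHAR('a) = 0 \<or> prime CHAR('a) \<and> CHAR('a) \<ge> 7"
    and "m \<ge> 5"
    and "CHAR('a) \<noteq> 0 \<Longrightarrow> m \<le> CHAR('a) - 1"
    and "primitive_root_of_unity m \<omega>"
  shows "Omega_orbit m \<omega> = curve_V m \<inter> proj_zeros (m - 1) {power_sum m (m - 1)}"
proof -
  note w = \<open>primitive_root_of_unity m \<omega>\<close>
  have m: "m \<ge> 1" using \<open>m \<ge> 5\<close> by simp
  \<comment> \<open>A positive characteristic exceeds \<open>m\<close> and so cannot divide
    \<open>k\<close>; characteristic 0 divides only 0.\<close>
  have char: "of_nat k \<noteq> (0::'a)" if "1 \<le> k" "k < m" for k
  proof
    assume "of_nat k = (0::'a)"
    then have "CHAR('a) dvd k" by (simp add: of_nat_eq_0_iff_char_dvd)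
    then show False
      using that assms(3) by (cases "CHAR('a) = 0") (auto dest: dvd_imp_le)
  qed
  define v :: "nat \<Rightarrow> 'a" where "v i = (if i \<in> {1..m} then \<omega> ^ i else 0)" for i
  have "\<omega> \<noteq> 0" using w by (auto simp: primitive_root_of_unity_def power_0_left)
  then have v: "v \<in> nonzero_vecs m"
    using m by (auto simp: nonzero_vecs_def v_def intro: bexI[of _ m])
  have psv: "power_sum m k v = 0" if "1 \<le> k" "k < m" for k
    using sum_primitive_root_power_eq_0[OF w that] by (simp add: power_sum_def v_def)
  have P: "P_point m \<omega> = proportional m `` {v}"
    using m by (simp add: P_point_def proj_point_def v_def[abs_def])
  have V: "curve_V m = {proportional m `` {x} |x. x \<in> nonzero_vecs m
      \<and> (\<forall>k\<in>{1..m - 2}. power_sum m k x = (0::'a))}"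
    unfolding curve_V_def by (rule proj_zeros_power_sum[OF m])
  \<comment> \<open>Membership is needed before the orbit can be unfolded, since
    \<open>coord_action\<close> is undefined off the curve.\<close>
  have PV: "P_point m \<omega> \<in> curve_V m"
    using v psv \<open>m \<ge> 5\<close> unfolding V P by (fastforce intro!: exI[of _ v])
  have "Omega_orbit m \<omega> = {proportional m `` {v \<circ> inv' \<sigma>} |\<sigma>. \<sigma> permutes {1..m}}"
  proof -
    have "coord_action m \<sigma> (P_point m \<omega>) = proportional m `` {v \<circ> inv' \<sigma>}"
      if "\<sigma> permutes {1..m}" for \<sigma>
      using PV proportional_permute[OF permutes_inv[OF that] v] by (simp add: coord_action_def P)
    then show ?thesis
      unfolding Omega_orbit_def orbit_def sym_group_def by auto
  qed
  also have "\<dots> = {proportional m `` {v \<circ> \<sigma>} |\<sigma>. \<sigma> permutes {1..m}}"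
    by (auto intro: permutes_inv) (metis permutes_inv permutes_inv_inv)
  also have "\<dots> = proj_zeros (m - 1) (power_sum m ` {1..m - 1})"
    unfolding proj_zeros_power_sum[OF m]
  proof (intro equalityI subsetI)
    fix Q assume "Q \<in> {proportional m `` {v \<circ> \<sigma>} |\<sigma>. \<sigma> permutes {1..m}}"
    then obtain \<sigma> where s: "\<sigma> permutes {1..m}" and Q: "Q = proportional m `` {v \<circ> \<sigma>}" by blast
    have "v \<circ> \<sigma> \<in> nonzero_vecs m" by (rule nonzero_vecs_permute[OF s v])
    moreover have "\<forall>k\<in>{1..m - 1}. power_sum m k (v \<circ> \<sigma>) = 0"
      using psv by (auto simp: power_sum_permute[OF s])
    ultimately show "Q \<in> {proportional m `` {x} |x. x \<in> nonzero_vecs m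
        \<and> (\<forall>k\<in>{1..m - 1}. power_sum m k x = 0)}" using Q by blast
  next
    fix Q assume "Q \<in> {proportional m `` {x} |x. x \<in> nonzero_vecs m
        \<and> (\<forall>k\<in>{1..m - 1}. power_sum m k x = (0::'a))}"
    then obtain x where x: "x \<in> nonzero_vecs m" and Q: "Q = proportional m `` {x}"
      and ps: "\<forall>k\<in>{1..m - 1}. power_sum m k x = 0" by blast
    obtain c \<sigma> where c: "c \<noteq> 0" and s: "\<sigma> permutes {1..m}"
      and xc: "\<And>i. i \<in> {1..m} \<Longrightarrow> x i = c * \<omega> ^ \<sigma> i"
      using power_sums_eq_0_imp_permuted_roots[OF w _ _ char, of x] x ps
      by (auto simp: nonzero_vecs_def)
    \<comment> \<open>Outside \<open>{1..m}\<close> both sides are 0, because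
      \<open>\<sigma>\<close> maps no outer index into \<open>{1..m}\<close>.\<close>
    have "x i = c * (v \<circ> \<sigma>) i" for i
      using x xc[of i] permutes_in_image[OF s, of i] by (auto simp: v_def nonzero_vecs_def)
    then have "(v \<circ> \<sigma>, x) \<in> proportional m"
      using c x nonzero_vecs_permute[OF s v] by (auto simp: proportional_def)
    then have "Q = proportional m `` {v \<circ> \<sigma>}"
      unfolding Q using equiv_class_eq[OF equiv_proportional] by metis
    then show "Q \<in> {proportional m `` {v \<circ> \<sigma>} |\<sigma>. \<sigma> permutes {1..m}}" using s by blast
  qed
  \<comment> \<open>The hypersurface supplies the one degree missing from the equations of the
    curve.\<close>
  also have "{1..m - 1} = insert (m - 1) {1..m - 2}" using \<open>m \<ge> 5\<close> by auto
  also have "proj_zeros (m - 1) (power_sum m ` \<dots>)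
      = curve_V m \<inter> proj_zeros (m - 1) {power_sum m (m - 1)}"
    by (auto simp: curve_V_def proj_zeros_def)
  finally show ?thesis .
qed

end
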